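(* Let $1<p\le 2$ and let $X$ be a separable Banach space with Azuma type $p$. Then $X$ is linearly isomorphic to a $p$-uniformly smooth Banach space.
   Context: For an $X$-valued martingale $f=(f_j)_{j\ge0}$ (filtration with trivial $\mathscr{F}_0$) let $d_{j,f}=f_j-f_{j-1}$ and $f^*=\sup_{j\in\mathbb{N}}\|f_j-f_0\|$. $X$ has Azuma type $p$ if there is a constant $K>0$ such that for every $X$-valued martingale $f$ and every nonnegative predictable sequence $w=(w_j)_{j\ge1}$ ($w_j$ measurable w.r.t. $\mathscr{F}_{j-1}$) with $\|d_{j,f}\|\le w_j$ for all $j$, one has $\mathbb{P}\{f^*\ge r\}\le 2\exp\{-r^p/(K\|\sum_{j=1}^\infty w_j^p\|_\infty)\}$ for all $r>0$. A Banach space $Y$ is $p$-uniformly smooth if there is $s>0$ with $\rho_Y(\tau)\le s\tau^p$ for all $\tau>0$, where $\rho_Y(\tau)=\sup\{\frac{\|x+\tau y\|+\|x-\tau y\|}{2}-1:\|x\|=\|y\|=1\}$. *)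

theory Defs
  imports "HOL-Probability.Probability"
begin

definition trivial_filtration :: "'s measure \<Rightarrow> (nat \<Rightarrow> 's measure) \<Rightarrow> bool" where
  "trivial_filtration M F \<longleftrightarrow>
     (\<forall>j. subalgebra M (F j)) \<and> (\<forall>j. sets (F j) \<subseteq> sets (F (Suc j))) \<and>
     sets (F 0) = {{}, space M}"

definition vec_martingale ::
  "'s measure \<Rightarrow> (nat \<Rightarrow> 's measure) \<Rightarrow> (nat \<Rightarrow> 's \<Rightarrow> 'a::{banach,second_countable_topology}) \<Rightarrow> bool" where
  "vec_martingale M F f \<longleftrightarrow>
     (\<forall>j. f j \<in> borel_measurable (F j)) \<and> (\<forall>j. integrable M (f j)) \<and>
     (\<forall>j. \<forall>A \<in> sets (F j). set_lebesgue_integral M A (f (Suc j)) = set_lebesgue_integral M A (f j))"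

definition mart_max :: "(nat \<Rightarrow> 's \<Rightarrow> 'a::real_normed_vector) \<Rightarrow> 's \<Rightarrow> ennreal" where
  "mart_max f \<omega> = (SUP j. ennreal (norm (f j \<omega> - f 0 \<omega>)))"

definition azuma_type :: "real \<Rightarrow> 'a::{banach,second_countable_topology} itself \<Rightarrow> bool" where
  "azuma_type p TYPE('a) \<longleftrightarrow>
     (\<exists>K>0. \<forall>(M::real measure) F (f::nat \<Rightarrow> real \<Rightarrow> 'a) (w::nat \<Rightarrow> real \<Rightarrow> real) B r.
        prob_space M \<longrightarrow> trivial_filtration M F \<longrightarrow> vec_martingale M F f \<longrightarrow>
        (\<forall>j. w (Suc j) \<in> borel_measurable (F j)) \<longrightarrow>
        (\<forall>j. \<forall>\<omega>\<in>space M. 0 \<le> w j \<omega>) \<longrightarrow>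
        (\<forall>j. \<forall>\<omega>\<in>space M. norm (f (Suc j) \<omega> - f j \<omega>) \<le> w (Suc j) \<omega>) \<longrightarrow>
        0 < B \<longrightarrow>
        (AE \<omega> in M. (\<Sum>j. ennreal (w (Suc j) \<omega> powr p)) \<le> ennreal B) \<longrightarrow>
        0 < r \<longrightarrow>
        measure M {\<omega> \<in> space M. ennreal r \<le> mart_max f \<omega>}
          \<le> 2 * exp (- (r powr p) / (K * B)))"

definition equivalent_norm :: "('a::real_normed_vector \<Rightarrow> real) \<Rightarrow> bool" where
  "equivalent_norm N \<longleftrightarrow>
     (\<forall>x y. N (x + y) \<le> N x + N y) \<and> (\<forall>c x. N (c *\<^sub>R x) = \<bar>c\<bar> * N x) \<and>
     (\<forall>x. N x = 0 \<longleftrightarrow> x = 0) \<and>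
     (\<exists>a b. 0 < a \<and> 0 < b \<and> (\<forall>x. a * norm x \<le> N x \<and> N x \<le> b * norm x))"

text \<open>p-uniform smoothness of (X, N): rho(tau) <= s tau^p, with the supremum
  defining rho unfolded.\<close>
definition p_uniformly_smooth_norm :: "real \<Rightarrow> ('a::real_normed_vector \<Rightarrow> real) \<Rightarrow> bool" where
  "p_uniformly_smooth_norm p N \<longleftrightarrow>
     (\<exists>s>0. \<forall>\<tau>>0. \<forall>x y. N x = 1 \<longrightarrow> N y = 1 \<longrightarrow>
        (N (x + \<tau> *\<^sub>R y) + N (x - \<tau> *\<^sub>R y)) / 2 - 1 \<le> s * \<tau> powr p)"

end

theory Submission
  imports Defs
begin

text \<open>
  Consider finite walks \<open>x + \<Sum>\<^sub>j d\<^sub>j\<close> in which each step is \<open>\<plusminus>y\<close> with equal probability and \<open>y\<close> depends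
  on the past. Here \<open>\<parallel>d\<^sub>j\<parallel>\<close> is predictable, so the Azuma inequality applies with \<open>w\<^sub>j = \<parallel>d\<^sub>j\<parallel>\<close>
  and gives \<open>E \<parallel>\<Sum> d\<^sub>j\<parallel> \<le> L\<close> whenever \<open>\<Sum> \<parallel>d\<^sub>j\<parallel>\<^sup>p \<le> 1\<close> on every path. Restarting the walk each time
  this unit budget is exhausted yields \<open>E \<parallel>\<Sum> d\<^sub>j\<parallel> \<le> L + C E \<Sum> \<parallel>d\<^sub>j\<parallel>\<^sup>p\<close> for all walks. Therefore
  \<open>u x = sup (E \<parallel>x + \<Sum> d\<^sub>j\<parallel> - C E \<Sum> \<parallel>d\<^sub>j\<parallel>\<^sup>p)\<close>, the supremum over all walks, is finite. It is even,
  convex and Lipschitz, and prepending a step \<open>\<plusminus>y\<close> shows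
  \<open>u (x + y) + u (x - y) \<le> 2 u x + 2 C \<parallel>y\<parallel>\<^sup>p\<close>. The Minkowski gauge of \<open>{u \<le> u 0 + 1}\<close> is the
  required norm.
\<close>

section \<open>Symmetric walks and their potential\<close>

text \<open>A dyadic (Paley-Walsh) martingale in the form of a binary tree: each step is stored at
  the node where it is taken, so it is a function of the earlier signs only.\<close>

datatype 'a walk = Stop | Step 'a "'a walk" "'a walk"

primrec mean_norm :: "'a::real_normed_vector \<Rightarrow> 'a walk \<Rightarrow> real" where
  "mean_norm x Stop = norm x"
| "mean_norm x (Step y l r) = (mean_norm (x + y) l + mean_norm (x - y) r) / 2"

primrec mean_cost :: "real \<Rightarrow> 'a::real_normed_vector walk \<Rightarrow> real" where
  "mean_cost p Stop = 0"
| "mean_cost p (Step y l r) = norm y powr p + (mean_cost p l + mean_cost p r) / 2"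

text \<open>The budget binds every path and not only the mean, because Azuma type measures the
  increments by an essential supremum.\<close>

primrec within_budget :: "real \<Rightarrow> real \<Rightarrow> 'a::real_normed_vector walk \<Rightarrow> bool" where
  "within_budget p b Stop \<longleftrightarrow> 0 \<le> b"
| "within_budget p b (Step y l r) \<longleftrightarrow>
     within_budget p (b - norm y powr p) l \<and> within_budget p (b - norm y powr p) r"

text \<open>Stops just before the first step that would overspend. The decision depends only on the
  past, so the result is again a walk.\<close>

primrec truncate :: "real \<Rightarrow> real \<Rightarrow> 'a::real_normed_vector walk \<Rightarrow> 'a walk" where
  "truncate p b Stop = Stop"
| "truncate p b (Step y l r) =
     (if norm y powr p \<le> b
      then Step y (truncate p (b - norm y powr p) l) (truncate p (b - norm y powr p) r)
      else Stop)"

primrec negate_walk :: "'a::real_normed_vector walk \<Rightarrow> 'a walk" where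
  "negate_walk Stop = Stop"
| "negate_walk (Step y l r) = Step (- y) (negate_walk l) (negate_walk r)"

section \<open>Dependence of the mean norm on the starting point\<close>

lemma mean_norm_negate: "mean_norm (- x) (negate_walk T) = mean_norm x T"
proof (induction T arbitrary: x)
  case Stop
  show ?case by simp
next
  case (Step y l r)
  have "- x + - y = - (x + y)" "- x - - y = - (x - y)" by auto
  then show ?case
    using Step.IH(1)[of "x + y"] Step.IH(2)[of "x - y"] by (simp only: mean_norm.simps negate_walk.simps)
qed

lemma mean_cost_negate: "mean_cost p (negate_walk T) = mean_cost p T"
  by (induction T) auto

text \<open>Running the same walk from both points keeps their difference fixed on every
  path.\<close>

lemma mean_norm_lipschitz: "mean_norm x T \<le> mean_norm x' T + norm (x - x')"
proof (induction T arbitrary: x x')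
  case Stop
  show ?case by (simp add: norm_triangle_sub add.commute)
next
  case (Step y l r)
  show ?case
    using Step.IH(1)[of "x + y" "x' + y"] Step.IH(2)[of "x - y" "x' - y"] by (simp add: field_simps)
qed

lemma mean_norm_convex:
  assumes "0 \<le> t" "t \<le> 1"
  shows "mean_norm (t *\<^sub>R x + (1 - t) *\<^sub>R z) T \<le> t * mean_norm x T + (1 - t) * mean_norm z T"
proof (induction T arbitrary: x z)
  case Stop
  show ?case
    using assms norm_triangle_ineq[of "t *\<^sub>R x" "(1 - t) *\<^sub>R z"] by simp
next
  case (Step y l r)
  have "t *\<^sub>R (x + y) + (1 - t) *\<^sub>R (z + y) = t *\<^sub>R x + (1 - t) *\<^sub>R z + y"
    "t *\<^sub>R (x - y) + (1 - t) *\<^sub>R (z - y) = t *\<^sub>R x + (1 - t) *\<^sub>R z - y"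
    by (simp_all add: algebra_simps)
  then show ?case
    using Step.IH(1)[of "x + y" "z + y"] Step.IH(2)[of "x - y" "z - y"]
    by (simp add: field_simps)
qed

section \<open>Restarting: from a unit budget to a cost bound\<close>

lemma within_budget_truncate: "0 \<le> b \<Longrightarrow> within_budget p b (truncate p b T)"
  by (induction T arbitrary: b) auto

text \<open>
  The term \<open>(L + 1) * (1 - b)\<close> pays in advance for a restart: the spent part \<open>1 - b\<close> of the budget
  has been charged at rate \<open>L + 1\<close>, so when a step exceeds the remaining \<open>b\<close>, the amount \<open>L + 1\<close>
  is available for a new walk with full budget.
\<close>

lemma mean_norm_le_truncate:
  fixes T :: "'a::real_normed_vector walk"
  assumes p: "1 < p"
    and L: "\<And>T::'a walk. within_budget p 1 T \<Longrightarrow> mean_norm 0 T \<le> L"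
    and b: "0 \<le> b" "b \<le> 1"
  shows "mean_norm x T \<le> mean_norm x (truncate p b T) + (L + 1) * (1 - b) + (L + 2) * mean_cost p T"
  using b
proof (induction T arbitrary: x b)
  have L0: "0 \<le> L" using L[of Stop] by simp
  {
    case Stop
    show ?case using Stop L0 by simp
  next
    case (Step y l r)
    show ?case
    proof (cases "norm y powr p \<le> b")
      case True
      let ?c = "b - norm y powr p"
      have "0 \<le> ?c" "?c \<le> 1" using True Step.prems by (auto intro: order_trans[of _ b])
      then have "mean_norm (x + y) l \<le> mean_norm (x + y) (truncate p ?c l) + (L + 1) * (1 - ?c) + (L + 2) * mean_cost p l"
        "mean_norm (x - y) r \<le> mean_norm (x - y) (truncate p ?c r) + (L + 1) * (1 - ?c) + (L + 2) * mean_cost p r"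
        using Step.IH by blast+
      moreover have "(L + 1) * norm y powr p \<le> (L + 2) * norm y powr p"
        by (intro mult_right_mono) auto
      moreover have "(L + 1) * (1 - ?c) = (L + 1) * (1 - b) + (L + 1) * norm y powr p"
        by (simp add: algebra_simps)
      moreover have "(L + 2) * mean_cost p (Step y l r) = (L + 2) * norm y powr p
          + ((L + 2) * mean_cost p l + (L + 2) * mean_cost p r) / 2"
        by (simp add: field_simps)
      moreover have trunc: "truncate p b (Step y l r) = Step y (truncate p ?c l) (truncate p ?c r)"
        using True by simp
      ultimately show ?thesis
        unfolding trunc mean_norm.simps by argo
    next
      case False
      \<comment> \<open>The truncated walk is \<open>Stop\<close> here. Each subtree is restarted
        from 0 with budget 1, where the prepaid term vanishes.\<close>
      have restart: "mean_norm 0 S \<le> L + (L + 2) * mean_cost p S"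
        if "mean_norm 0 S \<le> mean_norm 0 (truncate p 1 S) + (L + 1) * (1 - 1) + (L + 2) * mean_cost p S"
        for S :: "'a walk"
        using that L[OF within_budget_truncate[of 1 p S]] by simp
      have l: "mean_norm 0 l \<le> L + (L + 2) * mean_cost p l"
        by (rule restart, rule Step.IH(1)) auto
      have r: "mean_norm 0 r \<le> L + (L + 2) * mean_cost p r"
        by (rule restart, rule Step.IH(2)) auto
      have "mean_norm (x + y) l \<le> mean_norm 0 l + norm x + norm y"
        using mean_norm_lipschitz[of "x + y" l 0] norm_triangle_ineq[of x y] by simp
      moreover have "mean_norm (x - y) r \<le> mean_norm 0 r + norm x + norm y"
        using mean_norm_lipschitz[of "x - y" r 0] norm_triangle_ineq4[of x y] by simp
      \<comment> \<open>The overshooting step must be paid too. Its 1 joins the \<open>L\<close> of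
        the restart to give \<open>L + 1\<close>; its power, together with
        \<open>(L + 1) * b \<le> (L + 1) * norm y powr p\<close>, gives the cost rate
        \<open>L + 2\<close>.\<close>
      moreover have "norm y \<le> 1 + norm y powr p"
      proof (cases "norm y \<le> 1")
        case True
        then show ?thesis by (simp add: add_increasing2)
      next
        case False
        then show ?thesis using powr_mono[of 1 p "norm y"] p by simp
      qed
      moreover have "(L + 1) * b \<le> (L + 1) * norm y powr p"
        using False L0 by (intro mult_left_mono) auto
      ultimately show ?thesis
        using False l r by (simp add: field_simps)
    qed
  }
qed

lemma mean_norm_le_cost:
  fixes T :: "'a::real_normed_vector walk"
  assumes "1 < p"
    and L: "\<And>T::'a walk. within_budget p 1 T \<Longrightarrow> mean_norm 0 T \<le> L"
  shows "mean_norm 0 T \<le> L + (L + 2) * mean_cost p T"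
  using mean_norm_le_truncate[OF assms, of 1 0 T] L[OF within_budget_truncate[of 1 p T]]
  by simp

section \<open>The potential as the value of an optimisation over walks\<close>

definition walk_potential :: "real \<Rightarrow> real \<Rightarrow> 'a::real_normed_vector \<Rightarrow> real" where
  "walk_potential p C x = (SUP T. mean_norm x T - C * mean_cost p T)"

text \<open>The Lipschitz estimate moves the cost bound from 0 to \<open>x\<close> at the price of
  \<open>norm x\<close>, so the real supremum is over a set bounded above.\<close>

lemma walk_potential_ge:
  fixes x :: "'a::real_normed_vector"
  assumes L: "\<And>T::'a walk. mean_norm 0 T \<le> L + C * mean_cost p T"
  shows "mean_norm x T - C * mean_cost p T \<le> walk_potential p C x"
  unfolding walk_potential_def
proof (rule cSUP_upper)
  have "mean_norm x T - C * mean_cost p T \<le> L + norm x" for T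
    using L[of T] mean_norm_lipschitz[of x T 0] by simp
  then show "bdd_above (range (\<lambda>T. mean_norm x T - C * mean_cost p T))"
    by (intro bdd_aboveI2)
qed simp

lemma walk_potential_le:
  assumes "\<And>T. mean_norm x T - C * mean_cost p T \<le> b"
  shows "walk_potential p C x \<le> b"
  unfolding walk_potential_def by (rule cSUP_least) (auto intro: assms)

context
  fixes p C L :: real and u :: "'a::real_normed_vector \<Rightarrow> real"
  assumes bound: "\<And>T::'a walk. mean_norm 0 T \<le> L + C * mean_cost p T"
  defines "u \<equiv> walk_potential p C"
begin

lemmas potential_ge = walk_potential_ge[OF bound, folded u_def]
lemmas potential_le = walk_potential_le[where 'a = 'a and p = p and C = C, folded u_def]

lemma walk_potential_ge_norm: "norm x \<le> u x"
  using potential_ge[of x Stop] by simp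

lemma walk_potential_even: "u (- x) = u x"
proof -
  have "u (- z) \<le> u z" for z
  proof (rule potential_le)
    fix T
    show "mean_norm (- z) T - C * mean_cost p T \<le> u z"
      using potential_ge[of z "negate_walk T"] mean_norm_negate[of "- z" T]
      by (simp add: mean_cost_negate)
  qed
  from this[of x] this[of "- x"] show ?thesis by simp
qed

lemma walk_potential_lipschitz: "u x \<le> u z + norm (x - z)"
proof (rule potential_le)
  fix T
  show "mean_norm x T - C * mean_cost p T \<le> u z + norm (x - z)"
    using potential_ge[of z T] mean_norm_lipschitz[of x T z] by simp
qed

lemma walk_potential_convex:
  assumes "0 \<le> t" "t \<le> 1"
  shows "u (t *\<^sub>R x + (1 - t) *\<^sub>R z) \<le> t * u x + (1 - t) * u z"
proof (rule potential_le)
  fix T :: "'a walk"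
  let ?c = "C * mean_cost p T"
  have "mean_norm (t *\<^sub>R x + (1 - t) *\<^sub>R z) T - ?c
      \<le> t * (mean_norm x T - ?c) + (1 - t) * (mean_norm z T - ?c)"
    using mean_norm_convex[OF assms, of x z T] by (simp add: algebra_simps)
  also have "\<dots> \<le> t * u x + (1 - t) * u z"
    using assms by (intro add_mono mult_left_mono potential_ge) auto
  finally show "mean_norm (t *\<^sub>R x + (1 - t) *\<^sub>R z) T - ?c \<le> t * u x + (1 - t) * u z" .
qed

text \<open>Dynamic programming: \<open>Step y l r\<close> competes in the supremum at
  \<open>x\<close> for all continuations \<open>l\<close> and \<open>r\<close>. These vary
  independently, so the suprema at \<open>x + y\<close> and \<open>x - y\<close> can be taken one
  after the other.\<close>

lemma walk_potential_smooth: "u (x + y) + u (x - y) \<le> 2 * u x + 2 * C * norm y powr p"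
proof -
  have "u (x + y) \<le> 2 * u x + 2 * C * norm y powr p - u (x - y)"
  proof (rule potential_le)
    fix l
    have "u (x - y) \<le> 2 * u x + 2 * C * norm y powr p - (mean_norm (x + y) l - C * mean_cost p l)"
    proof (rule potential_le)
      fix r
      show "mean_norm (x - y) r - C * mean_cost p r
        \<le> 2 * u x + 2 * C * norm y powr p - (mean_norm (x + y) l - C * mean_cost p l)"
        using potential_ge[of x "Step y l r"] by (simp add: field_simps)
    qed
    then show "mean_norm (x + y) l - C * mean_cost p l \<le> 2 * u x + 2 * C * norm y powr p - u (x - y)"
      by simp
  qed
  then show ?thesis by simp
qed

end

section \<open>Walks as martingales\<close>

primrec walk_height :: "'a walk \<Rightarrow> nat" where
  "walk_height Stop = 0"
| "walk_height (Step y l r) = Suc (max (walk_height l) (walk_height r))"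

text \<open>Signs beyond the end of the walk are ignored, so all paths can be padded to one common
  length.\<close>

fun walk_pos :: "'a::real_normed_vector walk \<Rightarrow> bool list \<Rightarrow> 'a" where
  "walk_pos (Step y l r) (b # bs) = (if b then y + walk_pos l bs else - y + walk_pos r bs)"
| "walk_pos T bs = 0"

fun walk_incr :: "'a::real_normed_vector walk \<Rightarrow> bool list \<Rightarrow> 'a" where
  "walk_incr (Step y l r) (b # bs) = walk_incr (if b then l else r) bs"
| "walk_incr (Step y l r) [] = y"
| "walk_incr Stop bs = 0"

lemma walk_pos_Stop [simp]: "walk_pos Stop bs = 0"
  by (cases bs) auto

lemma walk_pos_Nil [simp]: "walk_pos T [] = 0"
  by (cases T) auto

lemma walk_pos_snoc:
  "walk_pos T (bs @ [b]) = walk_pos T bs + (if b then walk_incr T bs else - walk_incr T bs)"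
  by (induction T bs rule: walk_incr.induct) auto

text \<open>Prefixes beyond the end of \<open>bs\<close> are \<open>bs\<close> itself, where by the
  height condition the walk has stopped and the increment is 0. Hence the bound holds for every
  \<open>m\<close>, as the infinite series in Azuma type requires.\<close>

lemma walk_path_cost:
  assumes "within_budget p b T" "walk_height T \<le> length bs"
  shows "(\<Sum>j<m. norm (walk_incr T (take j bs)) powr p) \<le> b"
  using assms
proof (induction T arbitrary: b bs m)
  case Stop
  then show ?case by simp
next
  case (Step y l r)
  obtain c cs where bs: "bs = c # cs" using Step.prems by (cases bs) auto
  have ih: "(\<Sum>j<k. norm (walk_incr (if c then l else r) (take j cs)) powr p) \<le> b - norm y powr p" for k
    using Step bs by auto
  show ?case
  proof (cases m)
    case 0
    \<comment> \<open>The empty sum in \<open>ih\<close> says that \<open>b - norm y powr p\<close>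
      is nonnegative, hence so is \<open>b\<close>.\<close>
    then show ?thesis using ih[of 0] order_trans[of 0 "norm y powr p" b] by simp
  next
    case (Suc k)
    show ?thesis using ih[of k] unfolding Suc bs by (simp add: sum.lessThan_Suc_shift del: sum.lessThan_Suc)
  qed
qed

section \<open>Averages over sign strings\<close>

lemma lists_length_Suc:
  "{bs :: bool list. length bs = Suc n} = (#) True ` {bs. length bs = n} \<union> (#) False ` {bs. length bs = n}"
  by (auto simp: length_Suc_conv image_iff)

lemma finite_bool_lists: "finite {bs :: bool list. length bs = n}"
  using finite_lists_length_eq[of "UNIV :: bool set" n] by simp

lemma card_bool_lists: "card {bs :: bool list. length bs = n} = 2 ^ n"
  using card_lists_length_eq[of "UNIV :: bool set" n] by simp

lemma sum_lists_length_Suc: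
  fixes g :: "bool list \<Rightarrow> 'b::comm_monoid_add"
  shows "(\<Sum>bs | length bs = Suc n. g bs)
    = (\<Sum>bs | length bs = n. g (True # bs)) + (\<Sum>bs | length bs = n. g (False # bs))"
  unfolding lists_length_Suc
  by (subst sum.union_disjoint) (auto simp: finite_bool_lists sum.reindex)

text \<open>The first sign splits the strings between the two subtrees; surplus signs repeat an
  endpoint without changing the average.\<close>

lemma mean_norm_eq_average:
  assumes "walk_height T \<le> n"
  shows "(\<Sum>bs | length bs = n. norm (x + walk_pos T bs)) = 2 ^ n * mean_norm x T"
  using assms
proof (induction T arbitrary: x n)
  case Stop
  then show ?case by (simp add: card_bool_lists)
next
  case (Step y l r)
  then obtain k where n: "n = Suc k" by (cases n) auto
  have "(\<Sum>bs | length bs = n. norm (x + walk_pos (Step y l r) bs))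
      = (\<Sum>bs | length bs = k. norm ((x + y) + walk_pos l bs))
        + (\<Sum>bs | length bs = k. norm ((x - y) + walk_pos r bs))"
    unfolding n sum_lists_length_Suc by (simp add: add.assoc diff_conv_add_uminus del: add_uminus_conv_diff)
  also have "\<dots> = 2 ^ k * mean_norm (x + y) l + 2 ^ k * mean_norm (x - y) r"
    using Step n by simp
  finally show ?case by (simp add: n field_simps)
qed

text \<open>Flipping the sign at position \<open>j\<close> is an involution that keeps the prefix
  and negates the summand. This is the martingale property in finite form.\<close>

lemma sum_signed_prefix_eq_0:
  fixes g :: "bool list \<Rightarrow> 'b::real_vector"
  assumes "j < n"
  shows "(\<Sum>bs | length bs = n \<and> take j bs \<in> B. if bs ! j then g (take j bs) else - g (take j bs)) = 0"
proof -
  let ?S = "{bs. length bs = n \<and> take j bs \<in> B}"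
  let ?f = "\<lambda>bs. if bs ! j then g (take j bs) else - g (take j bs)"
  let ?flip = "\<lambda>bs. bs[j := \<not> bs ! j]"
  have "sum ?f ?S = (\<Sum>bs\<in>?S. - ?f bs)"
    using assms by (intro sum.reindex_bij_witness[of _ ?flip ?flip]) auto
  then have "sum ?f ?S = - sum ?f ?S" by (simp add: sum_negf)
  then have "2 *\<^sub>R sum ?f ?S = 0" by (simp add: scaleR_2 eq_neg_iff_add_eq_0)
  then show ?thesis by simp
qed

text \<open>
  The predicate \<open>azuma_type\<close> quantifies over measures on \<open>real\<close> only, so paths are coded as reals.
\<close>

definition path_code :: "bool list \<Rightarrow> real" where "path_code bs = real (to_nat bs)"

definition path_decode :: "real \<Rightarrow> bool list" where "path_decode \<omega> = from_nat (nat \<lfloor>\<omega>\<rfloor>)"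

lemma path_decode_code [simp]: "path_decode (path_code bs) = bs"
  by (simp add: path_code_def path_decode_def)

lemma inj_path_code: "inj_on path_code A"
  by (metis inj_onI path_decode_code)

section \<open>The path space, its filtration and the walk martingale\<close>

definition path_measure :: "nat \<Rightarrow> real measure" where
  "path_measure n = uniform_count_measure (path_code ` {bs. length bs = n})"

text \<open>The sigma-algebra generated by the first \<open>j\<close> signs. It is constant from
  \<open>j = n\<close> on, which extends the finite walk to infinite time.\<close>

definition path_filtration :: "nat \<Rightarrow> nat \<Rightarrow> real measure" where
  "path_filtration n j =
     vimage_algebra (space (path_measure n)) (\<lambda>\<omega>. take j (path_decode \<omega>)) (count_space UNIV)"

lemma space_path_measure: "space (path_measure n) = path_code ` {bs. length bs = n}"
  by (simp add: path_measure_def space_uniform_count_measure)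

lemma sets_path_measure: "sets (path_measure n) = Pow (space (path_measure n))"
  by (simp add: path_measure_def space_uniform_count_measure sets_uniform_count_measure)

lemma sets_path_filtration:
  "sets (path_filtration n j) = {(\<lambda>\<omega>. take j (path_decode \<omega>)) -` B \<inter> space (path_measure n) | B. True}"
  by (simp add: path_filtration_def sets_vimage_algebra2)

lemma measurable_path_filtration:
  "(\<lambda>\<omega>. g (take j (path_decode \<omega>))) \<in> borel_measurable (path_filtration n j)"
  unfolding path_filtration_def
  by (rule measurable_compose[OF measurable_vimage_algebra1]) auto

lemma prob_space_path_measure: "prob_space (path_measure n)"
proof -
  have "replicate n True \<in> {bs. length bs = n}" by simp
  then show ?thesis
    unfolding path_measure_def by (intro prob_space_uniform_count_measure) (use finite_bool_lists in blast)+
qed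

lemma trivial_filtration_path: "trivial_filtration (path_measure n) (path_filtration n)"
  unfolding trivial_filtration_def
proof (intro conjI allI)
  fix j
  show "subalgebra (path_measure n) (path_filtration n j)"
  proof -
    have "space (path_filtration n j) = space (path_measure n)"
      by (simp add: path_filtration_def)
    moreover have "sets (path_filtration n j) \<subseteq> sets (path_measure n)"
      unfolding sets_path_measure sets_path_filtration by blast
    ultimately show ?thesis by (simp add: subalgebra_def)
  qed
  show "sets (path_filtration n j) \<subseteq> sets (path_filtration n (Suc j))"
  proof
    fix A assume "A \<in> sets (path_filtration n j)"
    then obtain B where "A = (\<lambda>\<omega>. take j (path_decode \<omega>)) -` B \<inter> space (path_measure n)"
      by (auto simp: sets_path_filtration)
    \<comment> \<open>The \<open>j\<close>-prefix is a function of the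
      \<open>Suc j\<close>-prefix.\<close>
    then have "A = (\<lambda>\<omega>. take (Suc j) (path_decode \<omega>)) -` (take j -` B) \<inter> space (path_measure n)"
      by (auto simp: min_def)
    then show "A \<in> sets (path_filtration n (Suc j))"
      unfolding sets_path_filtration by blast
  qed
next
  \<comment> \<open>The empty prefix is constant, so its preimages are empty or everything.\<close>
  have "{(\<lambda>\<omega>. []) -` B \<inter> space (path_measure n) | B :: bool list set. True} = {{}, space (path_measure n)}"
  proof (intro equalityI subsetI)
    fix A assume "A \<in> {{}, space (path_measure n)}"
    then have "A = (\<lambda>\<omega>. []) -` {} \<inter> space (path_measure n) \<or> A = (\<lambda>\<omega>. []) -` (UNIV :: bool list set) \<inter> space (path_measure n)"
      by auto
    then show "A \<in> {(\<lambda>\<omega>. []) -` B \<inter> space (path_measure n) | B :: bool list set. True}" by blast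
  next
    fix A assume "A \<in> {(\<lambda>\<omega>. []) -` B \<inter> space (path_measure n) | B :: bool list set. True}"
    then obtain B :: "bool list set" where "A = (\<lambda>\<omega>. []) -` B \<inter> space (path_measure n)" by blast
    then show "A \<in> {{}, space (path_measure n)}" by (cases "[] \<in> B") auto
  qed
  then show "sets (path_filtration n 0) = {{}, space (path_measure n)}"
    by (simp add: sets_path_filtration)
qed

lemma integral_path_measure:
  fixes g :: "real \<Rightarrow> 'b::{banach,second_countable_topology}"
  shows "integral\<^sup>L (path_measure n) g = (\<Sum>bs | length bs = n. g (path_code bs)) /\<^sub>R 2 ^ n"
proof -
  have "integral\<^sup>L (path_measure n) g
      = (\<Sum>\<omega>\<in>path_code ` {bs. length bs = n}. (1 / 2 ^ n) *\<^sub>R g \<omega>)"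
    unfolding path_measure_def uniform_count_measure_def
    by (subst lebesgue_integral_point_measure_finite)
       (auto simp: finite_bool_lists card_image inj_path_code card_bool_lists)
  then show ?thesis
    by (simp add: sum.reindex inj_path_code scaleR_sum_right divide_inverse)
qed

lemma integrable_path_measure:
  fixes g :: "real \<Rightarrow> 'b::{banach,second_countable_topology}"
  shows "integrable (path_measure n) g"
  unfolding path_measure_def uniform_count_measure_def
  by (rule integrable_point_measure_finite) (simp add: finite_bool_lists)

text \<open>An event of stage \<open>j\<close> is given by a set \<open>B\<close> of prefixes, which
  turns set integrals into sums over strings. The next increment is a sign times a function of the
  prefix and cancels.\<close>

lemma vec_martingale_walk:
  fixes T :: "'a::{banach,second_countable_topology} walk"
  shows "vec_martingale (path_measure n) (path_filtration n) (\<lambda>j \<omega>. walk_pos T (take j (path_decode \<omega>)))"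
  unfolding vec_martingale_def
proof (intro conjI allI ballI)
  fix j A
  show "(\<lambda>\<omega>. walk_pos T (take j (path_decode \<omega>))) \<in> borel_measurable (path_filtration n j)"
    by (rule measurable_path_filtration)
  show "integrable (path_measure n) (\<lambda>\<omega>. walk_pos T (take j (path_decode \<omega>)))"
    by (rule integrable_path_measure)
  assume "A \<in> sets (path_filtration n j)"
  then obtain B where A: "A = (\<lambda>\<omega>. take j (path_decode \<omega>)) -` B \<inter> space (path_measure n)"
    by (auto simp: sets_path_filtration)
  have ind: "indicator A (path_code bs) = (indicator B (take j bs) :: real)" if "length bs = n" for bs
    using that by (auto simp: A space_path_measure indicator_def)
  have set_integral: "set_lebesgue_integral (path_measure n) A (\<lambda>\<omega>. g (path_decode \<omega>))
      = (\<Sum>bs | length bs = n \<and> take j bs \<in> B. g bs) /\<^sub>R 2 ^ n" for g :: "bool list \<Rightarrow> 'a"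
  proof -
    have "(\<Sum>bs | length bs = n. indicator A (path_code bs) *\<^sub>R g bs)
        = (\<Sum>bs | length bs = n. if take j bs \<in> B then g bs else 0)"
      by (intro sum.cong) (auto simp: ind)
    also have "\<dots> = (\<Sum>bs | length bs = n \<and> take j bs \<in> B. g bs)"
      by (simp add: sum.inter_filter[OF finite_bool_lists, symmetric])
    finally show ?thesis
      unfolding set_lebesgue_integral_def integral_path_measure by simp
  qed
  have "(\<Sum>bs | length bs = n \<and> take j bs \<in> B. walk_pos T (take (Suc j) bs))
      = (\<Sum>bs | length bs = n \<and> take j bs \<in> B. walk_pos T (take j bs))"
  \<comment> \<open>For \<open>j \<ge> n\<close> both prefixes are the whole string and the sums
    agree term by term.\<close>
  proof (cases "j < n")
    case True
    have "(\<Sum>bs | length bs = n \<and> take j bs \<in> B. walk_pos T (take (Suc j) bs))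
        = (\<Sum>bs | length bs = n \<and> take j bs \<in> B. walk_pos T (take j bs)
            + (if bs ! j then walk_incr T (take j bs) else - walk_incr T (take j bs)))"
      using True by (intro sum.cong) (auto simp: take_Suc_conv_app_nth walk_pos_snoc)
    then show ?thesis
      by (simp only: sum.distrib sum_signed_prefix_eq_0[OF True] add_0_right)
  qed (auto intro!: sum.cong)
  then show "set_lebesgue_integral (path_measure n) A (\<lambda>\<omega>. walk_pos T (take (Suc j) (path_decode \<omega>)))
      = set_lebesgue_integral (path_measure n) A (\<lambda>\<omega>. walk_pos T (take j (path_decode \<omega>)))"
    using set_integral[of "\<lambda>bs. walk_pos T (take (Suc j) bs)"] set_integral[of "\<lambda>bs. walk_pos T (take j bs)"]
    by simp
qed

section \<open>From Azuma type to a uniform mean bound\<close>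

lemma azuma_type_walk_tail:
  assumes "azuma_type p TYPE('a::{banach,second_countable_topology})"
  obtains K where "0 < K"
    "\<And>(T :: 'a walk) n r. within_budget p 1 T \<Longrightarrow> walk_height T \<le> n \<Longrightarrow> 0 < r \<Longrightarrow>
       real (card {bs. length bs = n \<and> r \<le> norm (walk_pos T bs)}) \<le> 2 ^ n * (2 * exp (- (r powr p) / K))"
proof -
  from assms[unfolded azuma_type_def] obtain K where K_azuma: "K > 0 \<and>
    (\<forall>(M::real measure) F (f::nat \<Rightarrow> real \<Rightarrow> 'a) (w::nat \<Rightarrow> real \<Rightarrow> real) B r.
        prob_space M \<longrightarrow> trivial_filtration M F \<longrightarrow> vec_martingale M F f \<longrightarrow>
        (\<forall>j. w (Suc j) \<in> borel_measurable (F j)) \<longrightarrow>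
        (\<forall>j. \<forall>\<omega>\<in>space M. 0 \<le> w j \<omega>) \<longrightarrow>
        (\<forall>j. \<forall>\<omega>\<in>space M. norm (f (Suc j) \<omega> - f j \<omega>) \<le> w (Suc j) \<omega>) \<longrightarrow>
        0 < B \<longrightarrow>
        (AE \<omega> in M. (\<Sum>j. ennreal (w (Suc j) \<omega> powr p)) \<le> ennreal B) \<longrightarrow>
        0 < r \<longrightarrow>
        measure M {\<omega> \<in> space M. ennreal r \<le> mart_max f \<omega>}
          \<le> 2 * exp (- (r powr p) / (K * B)))" ..
  note K = conjunct1[OF K_azuma] and azuma = conjunct2[OF K_azuma, rule_format]
  show thesis
  proof (rule that[OF K])
    fix T :: "'a walk" and n :: nat and r :: real
    assume T: "within_budget p 1 T" "walk_height T \<le> n" and r: "0 < r"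
    let ?f = "\<lambda>j \<omega>. walk_pos T (take j (path_decode \<omega>))"
    \<comment> \<open>The shift \<open>j - 1\<close> makes \<open>?w (Suc j)\<close> a function of
      the first \<open>j\<close> signs, which is predictability.\<close>
    let ?w = "\<lambda>j \<omega>. norm (walk_incr T (take (j - 1) (path_decode \<omega>)))"
    let ?M = "path_measure n"
    have "measure ?M {\<omega> \<in> space ?M. ennreal r \<le> mart_max ?f \<omega>} \<le> 2 * exp (- (r powr p) / (K * 1))"
    proof (rule azuma[where F = "path_filtration n" and w = ?w])
      show "?w (Suc j) \<in> borel_measurable (path_filtration n j)" for j
        by (simp add: measurable_path_filtration[of "\<lambda>bs. norm (walk_incr T bs)"])
      show "norm (?f (Suc j) \<omega> - ?f j \<omega>) \<le> ?w (Suc j) \<omega>" for j \<omega>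
        by (cases "j < length (path_decode \<omega>)") (auto simp: take_Suc_conv_app_nth walk_pos_snoc)
      show "AE \<omega> in ?M. (\<Sum>j. ennreal (?w (Suc j) \<omega> powr p)) \<le> ennreal 1"
      proof (rule AE_I2)
        fix \<omega> assume "\<omega> \<in> space ?M"
        then have len: "walk_height T \<le> length (path_decode \<omega>)"
          using T by (auto simp: space_path_measure)
        show "(\<Sum>j. ennreal (?w (Suc j) \<omega> powr p)) \<le> ennreal 1"
          unfolding suminf_eq_SUP
        proof (rule SUP_least)
          fix m
          show "(\<Sum>j<m. ennreal (?w (Suc j) \<omega> powr p)) \<le> ennreal 1"
            using walk_path_cost[OF T(1) len, of m] by (subst sum_ennreal) (auto intro!: ennreal_leI)
        qed
      qed
    qed (use r in \<open>auto simp: prob_space_path_measure trivial_filtration_path vec_martingale_walk\<close>)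
    moreover have "measure ?M (path_code ` {bs. length bs = n \<and> r \<le> norm (walk_pos T bs)})
        \<le> measure ?M {\<omega> \<in> space ?M. ennreal r \<le> mart_max ?f \<omega>}"
    proof (rule finite_measure.finite_measure_mono)
      show "finite_measure ?M"
        using prob_space_path_measure prob_space.finite_measure by blast
      show "path_code ` {bs. length bs = n \<and> r \<le> norm (walk_pos T bs)}
          \<subseteq> {\<omega> \<in> space ?M. ennreal r \<le> mart_max ?f \<omega>}"
      proof (clarsimp simp: space_path_measure)
        fix bs assume "r \<le> norm (walk_pos T bs)"
        \<comment> \<open>The walk starts at 0, so the norm of the endpoint is the term of index
          \<open>length bs\<close> in the maximal function.\<close>
        then have "ennreal r \<le> ennreal (norm (?f (length bs) (path_code bs) - ?f 0 (path_code bs)))"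
          by (simp add: ennreal_leI)
        also have "\<dots> \<le> mart_max ?f (path_code bs)"
          unfolding mart_max_def by (rule SUP_upper) simp
        finally show "ennreal r \<le> mart_max ?f (path_code bs)" .
      qed
    qed (simp add: sets_path_measure)
    moreover have "measure ?M (path_code ` {bs. length bs = n \<and> r \<le> norm (walk_pos T bs)})
        = card {bs. length bs = n \<and> r \<le> norm (walk_pos T bs)} / 2 ^ n"
      unfolding path_measure_def
      by (subst measure_uniform_count_measure)
         (auto simp: finite_bool_lists card_image inj_path_code card_bool_lists)
    ultimately have "card {bs. length bs = n \<and> r \<le> norm (walk_pos T bs)} / 2 ^ n
        \<le> 2 * exp (- (r powr p) / K)"
      by simp
    then show "real (card {bs. length bs = n \<and> r \<le> norm (walk_pos T bs)})
        \<le> 2 ^ n * (2 * exp (- (r powr p) / K))"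
      by (simp add: divide_le_eq mult.commute)
  qed
qed

text \<open>A discrete layer-cake estimate: the sum counts the positive integers up to
  \<open>z\<close>, and \<open>m\<close> is large enough to include them all.\<close>

lemma le_one_plus_count:
  fixes z :: real
  assumes "0 \<le> z" "z \<le> real m"
  shows "z \<le> 1 + (\<Sum>k<m. of_bool (real (Suc k) \<le> z))"
proof -
  have "(\<Sum>k<m. of_bool (real (Suc k) \<le> z)) = real (card {k\<in>{..<m}. real (Suc k) \<le> z})"
    by (simp add: of_bool_def sum.If_cases Int_def)
  also have "{k\<in>{..<m}. real (Suc k) \<le> z} = {..<nat \<lfloor>z\<rfloor>}"
  proof (intro set_eqI iffI)
    fix k assume "k \<in> {k\<in>{..<m}. real (Suc k) \<le> z}"
    then have "Suc k \<le> nat \<lfloor>z\<rfloor>" by (intro le_nat_floor) simp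
    then show "k \<in> {..<nat \<lfloor>z\<rfloor>}" by simp
  next
    fix k assume "k \<in> {..<nat \<lfloor>z\<rfloor>}"
    then have "real (Suc k) \<le> real (nat \<lfloor>z\<rfloor>)" by (simp only: of_nat_le_iff lessThan_iff Suc_le_eq)
    also have "\<dots> \<le> z" using assms by simp
    finally have k: "real (Suc k) \<le> z" .
    then have "k < m" using assms by linarith
    then show "k \<in> {k\<in>{..<m}. real (Suc k) \<le> z}" using k by simp
  qed
  finally have "(\<Sum>k<m. of_bool (real (Suc k) \<le> z)) = real (nat \<lfloor>z\<rfloor>)" by simp
  then show ?thesis using assms by linarith
qed

text \<open>Summing the tails bounds the mean by a constant depending only on \<open>K\<close>;
  neither the height \<open>n\<close> nor the cutoff \<open>m\<close> survives.\<close>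

lemma azuma_type_mean_norm_bound:
  assumes p: "1 < p" and az: "azuma_type p TYPE('a::{banach,second_countable_topology})"
  obtains L where "\<And>T::'a walk. within_budget p 1 T \<Longrightarrow> mean_norm 0 T \<le> L"
proof -
  obtain K where K: "0 < K" and tail:
    "\<And>(T :: 'a walk) n r. within_budget p 1 T \<Longrightarrow> walk_height T \<le> n \<Longrightarrow> 0 < r \<Longrightarrow>
       real (card {bs. length bs = n \<and> r \<le> norm (walk_pos T bs)}) \<le> 2 ^ n * (2 * exp (- (r powr p) / K))"
    by (rule azuma_type_walk_tail[OF az]) blast
  define q where "q = exp (- 1 / K)"
  have q: "0 < q" "q < 1" using K by (auto simp: q_def)
  \<comment> \<open>Since \<open>p > 1\<close>, the power \<open>real (Suc k) powr p\<close> is at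
    least \<open>k\<close>, so the tails are dominated by a geometric series.\<close>
  have qk: "exp (- (real (Suc k) powr p) / K) \<le> q ^ k" for k
  proof -
    have "real (Suc k) powr 1 \<le> real (Suc k) powr p" using p by (intro powr_mono) auto
    then have "real k \<le> real (Suc k) powr p" by simp
    then have "exp (- (real (Suc k) powr p) / K) \<le> exp (real k * (- 1 / K))"
      using K by (simp add: divide_right_mono)
    then show ?thesis by (simp only: q_def exp_of_nat_mult)
  qed
  show thesis
  proof (rule that)
    fix T :: "'a walk" assume T: "within_budget p 1 T"
    define n where "n = walk_height T"
    let ?S = "{bs :: bool list. length bs = n}"
    obtain m where m: "\<And>bs. bs \<in> ?S \<Longrightarrow> norm (walk_pos T bs) \<le> real m"
    proof -
      have "finite ((\<lambda>bs. norm (walk_pos T bs)) ` ?S)" by (simp add: finite_bool_lists)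
      then obtain c where c: "\<And>bs. bs \<in> ?S \<Longrightarrow> norm (walk_pos T bs) \<le> c"
        using bdd_above_finite unfolding bdd_above_def by (metis imageI)
      obtain m where "c \<le> real m" using real_arch_simple by blast
      then show thesis using that c order_trans by blast
    qed
    have "2 ^ n * mean_norm 0 T = (\<Sum>bs\<in>?S. norm (walk_pos T bs))"
      using mean_norm_eq_average[of T n 0] by (simp add: n_def)
    also have "\<dots> \<le> (\<Sum>bs\<in>?S. 1 + (\<Sum>k<m. of_bool (real (Suc k) \<le> norm (walk_pos T bs))))"
      using m by (intro sum_mono le_one_plus_count) auto
    also have "\<dots> = 2 ^ n + (\<Sum>k<m. \<Sum>bs\<in>?S. of_bool (real (Suc k) \<le> norm (walk_pos T bs)))"
      by (subst sum.swap) (simp add: sum.distrib card_bool_lists)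
    also have "\<dots> = 2 ^ n + (\<Sum>k<m. real (card {bs. length bs = n \<and> real (Suc k) \<le> norm (walk_pos T bs)}))"
      by (simp add: of_bool_def sum.If_cases finite_bool_lists Int_def)
    also have "\<dots> \<le> 2 ^ n + (\<Sum>k<m. 2 ^ n * (2 * q ^ k))"
    proof (intro add_left_mono sum_mono)
      fix k
      have "real (card {bs. length bs = n \<and> real (Suc k) \<le> norm (walk_pos T bs)})
          \<le> 2 ^ n * (2 * exp (- (real (Suc k) powr p) / K))"
        using T by (intro tail) (auto simp: n_def)
      also have "\<dots> \<le> 2 ^ n * (2 * q ^ k)" using qk[of k] by simp
      finally show "real (card {bs. length bs = n \<and> real (Suc k) \<le> norm (walk_pos T bs)})
          \<le> 2 ^ n * (2 * q ^ k)" .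
    qed
    also have "\<dots> = 2 ^ n * (1 + 2 * (\<Sum>k<m. q ^ k))"
      by (simp add: sum_distrib_left algebra_simps)
    also have "\<dots> \<le> 2 ^ n * (1 + 2 * (1 / (1 - q)))"
    proof -
      have "(\<Sum>k<m. q ^ k) \<le> (\<Sum>k. q ^ k)"
        using q by (intro sum_le_suminf summable_geometric) auto
      also have "\<dots> = 1 / (1 - q)" using q by (intro suminf_geometric) auto
      finally show ?thesis by simp
    qed
    finally show "mean_norm 0 T \<le> 1 + 2 * (1 / (1 - q))" by simp
  qed
qed

section \<open>The gauge of a smooth potential\<close>

locale smooth_potential =
  fixes u :: "'a::real_normed_vector \<Rightarrow> real" and p C :: real
  assumes p: "1 < p" and C: "0 \<le> C"
    and ge_norm: "norm x \<le> u x"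
    and even: "u (- x) = u x"
    and lipschitz: "u x \<le> u z + norm (x - z)"
    and convex: "0 \<le> t \<Longrightarrow> t \<le> 1 \<Longrightarrow> u (t *\<^sub>R x + (1 - t) *\<^sub>R z) \<le> t * u x + (1 - t) * u z"
    and smooth: "u (x + y) + u (x - y) \<le> 2 * u x + 2 * C * norm y powr p"
begin

text \<open>One unit above \<open>u 0\<close>: the Lipschitz bound then puts the unit ball inside
  the sublevel set, and convexity forces \<open>u\<close> to drop at a definite rate from the
  boundary towards 0.\<close>

definition level :: real where "level = u 0 + 1"

definition gauge_scales :: "'a \<Rightarrow> real set" where
  "gauge_scales x = {t. 0 < t \<and> u (x /\<^sub>R t) \<le> level}"

definition gauge_norm :: "'a \<Rightarrow> real" where
  "gauge_norm x = Inf (gauge_scales x)"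

lemma u0_nonneg: "0 \<le> u 0"
  using ge_norm[of 0] by simp

lemma level_pos: "0 < level"
  using u0_nonneg by (simp add: level_def)

lemma u_shrink:
  assumes "0 \<le> t" "t \<le> 1"
  shows "u (t *\<^sub>R x) \<le> t * u x + (1 - t) * u 0"
  using convex[OF assms, of x 0] by simp

text \<open>As \<open>u\<close> dominates the norm, the sublevel set lies in the ball of radius
  \<open>level\<close>.\<close>

lemma gauge_scales_lower:
  assumes "t \<in> gauge_scales x"
  shows "norm x / level \<le> t"
proof -
  have t: "0 < t" and "u (x /\<^sub>R t) \<le> level" using assms by (auto simp: gauge_scales_def)
  then have "norm (x /\<^sub>R t) \<le> level" using ge_norm order_trans by blast
  then show ?thesis using t level_pos by (simp add: field_simps)
qed

lemma bdd_below_gauge_scales: "bdd_below (gauge_scales x)"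
  using gauge_scales_lower by (rule bdd_belowI)

lemma gauge_scales_memI:
  assumes "0 < t" "norm x \<le> t"
  shows "t \<in> gauge_scales x"
proof -
  have "norm (x /\<^sub>R t) \<le> 1" using assms by (simp add: field_simps)
  then show ?thesis
    using assms lipschitz[of "x /\<^sub>R t" 0] by (simp add: gauge_scales_def level_def)
qed

lemma gauge_scales_nonempty: "gauge_scales x \<noteq> {}"
proof -
  have "norm x + 1 \<in> gauge_scales x"
    by (rule gauge_scales_memI) (auto intro: add_nonneg_pos)
  then show ?thesis by blast
qed

lemma gauge_norm_le: "t \<in> gauge_scales x \<Longrightarrow> gauge_norm x \<le> t"
  unfolding gauge_norm_def by (rule cInf_lower) (auto intro: bdd_below_gauge_scales)

lemma gauge_norm_ge: "norm x / level \<le> gauge_norm x"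
  unfolding gauge_norm_def using gauge_scales_nonempty gauge_scales_lower by (rule cInf_greatest)

lemma gauge_norm_nonneg: "0 \<le> gauge_norm x"
  by (rule order_trans[OF _ gauge_norm_ge]) (simp add: level_pos less_imp_le)

lemma gauge_norm_le_norm: "gauge_norm x \<le> norm x"
proof (rule field_le_epsilon)
  fix e :: real assume "0 < e"
  then show "gauge_norm x \<le> norm x + e"
    by (intro gauge_norm_le gauge_scales_memI) (auto intro: add_nonneg_pos)
qed

text \<open>The normalised sum is the convex combination of the normalised points with weight
  \<open>s / (s + t)\<close>.\<close>

lemma gauge_scales_add:
  assumes "s \<in> gauge_scales x" "t \<in> gauge_scales z"
  shows "s + t \<in> gauge_scales (x + z)"
proof -
  have st: "0 < s" "0 < t" using assms by (auto simp: gauge_scales_def)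
  let ?a = "s / (s + t)"
  have a: "1 - ?a = t / (s + t)" using st by (simp add: field_simps)
  have "?a *\<^sub>R (x /\<^sub>R s) = x /\<^sub>R (s + t)" "(t / (s + t)) *\<^sub>R (z /\<^sub>R t) = z /\<^sub>R (s + t)"
    using st by (simp_all add: field_simps)
  then have "(x + z) /\<^sub>R (s + t) = ?a *\<^sub>R (x /\<^sub>R s) + (1 - ?a) *\<^sub>R (z /\<^sub>R t)"
    unfolding a by (simp only: scaleR_add_right)
  then have "u ((x + z) /\<^sub>R (s + t)) \<le> ?a * u (x /\<^sub>R s) + (1 - ?a) * u (z /\<^sub>R t)"
    using convex[of ?a "x /\<^sub>R s" "z /\<^sub>R t"] st by simp
  also have "\<dots> \<le> ?a * level + (1 - ?a) * level"
    using assms st by (intro add_mono mult_left_mono) (auto simp: gauge_scales_def)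
  finally show ?thesis using st by (simp add: gauge_scales_def algebra_simps)
qed

lemma gauge_norm_approx:
  assumes "0 < e"
  obtains t where "t \<in> gauge_scales x" "t < gauge_norm x + e"
proof -
  have "Inf (gauge_scales x) < gauge_norm x + e"
    using assms by (simp add: gauge_norm_def)
  from cInf_lessD[OF gauge_scales_nonempty this] show thesis using that by blast
qed

lemma gauge_norm_triangle: "gauge_norm (x + z) \<le> gauge_norm x + gauge_norm z"
proof (rule field_le_epsilon)
  fix e :: real assume "0 < e"
  then have e: "0 < e / 2" by simp
  obtain s t where "s \<in> gauge_scales x" "s < gauge_norm x + e / 2" "t \<in> gauge_scales z" "t < gauge_norm z + e / 2"
    using gauge_norm_approx[OF e] by metis
  then show "gauge_norm (x + z) \<le> gauge_norm x + gauge_norm z + e"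
    using gauge_norm_le[OF gauge_scales_add, of s x t z] by simp
qed

lemma gauge_norm_minus: "gauge_norm (- x) = gauge_norm x"
  by (simp add: gauge_norm_def gauge_scales_def even)

lemma gauge_norm_scaleR_pos_le:
  assumes "0 < c"
  shows "gauge_norm (c *\<^sub>R x) \<le> c * gauge_norm x"
proof (rule field_le_epsilon)
  fix e :: real assume "0 < e"
  then have "0 < e / c" using assms by simp
  then obtain t where t: "t \<in> gauge_scales x" "t < gauge_norm x + e / c"
    by (rule gauge_norm_approx)
  then have "c * t \<in> gauge_scales (c *\<^sub>R x)"
    using assms by (auto simp: gauge_scales_def field_simps)
  then have "gauge_norm (c *\<^sub>R x) \<le> c * t" by (rule gauge_norm_le)
  also have "\<dots> \<le> c * (gauge_norm x + e / c)" using t assms by simp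
  also have "\<dots> = c * gauge_norm x + e" using assms by (simp add: distrib_left)
  finally show "gauge_norm (c *\<^sub>R x) \<le> c * gauge_norm x + e" .
qed

lemma gauge_norm_zero: "gauge_norm 0 = 0"
  using gauge_norm_le_norm[of 0] gauge_norm_nonneg[of 0] by simp

lemma gauge_norm_scaleR: "gauge_norm (c *\<^sub>R x) = \<bar>c\<bar> * gauge_norm x"
proof -
  have pos: "gauge_norm (c *\<^sub>R x) = c * gauge_norm x" if "0 < c" for c
  proof (rule antisym)
    show "gauge_norm (c *\<^sub>R x) \<le> c * gauge_norm x"
      using that by (rule gauge_norm_scaleR_pos_le)
    show "c * gauge_norm x \<le> gauge_norm (c *\<^sub>R x)"
      using gauge_norm_scaleR_pos_le[of "inverse c" "c *\<^sub>R x"] that by (simp add: field_simps)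
  qed
  consider "0 < c" | "c = 0" | "0 < - c" by linarith
  then show ?thesis
  proof cases
    case 3
    then show ?thesis using pos[of "- c"] gauge_norm_minus[of "c *\<^sub>R x"] by simp
  qed (auto simp: pos gauge_norm_zero)
qed

lemma equivalent_gauge_norm: "equivalent_norm gauge_norm"
  unfolding equivalent_norm_def
proof (intro conjI allI exI)
  show "0 < 1 / level" using level_pos by simp
  show "1 / level * norm x \<le> gauge_norm x" for x using gauge_norm_ge[of x] by simp
  show "gauge_norm x \<le> 1 * norm x" for x using gauge_norm_le_norm[of x] by simp
  show "gauge_norm x = 0 \<longleftrightarrow> x = 0" for x
  proof
    assume "gauge_norm x = 0"
    then have "norm x / level \<le> 0" using gauge_norm_ge[of x] by simp
    then have "norm x \<le> 0" using level_pos by (simp add: pos_divide_le_eq)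
    then show "x = 0" by simp
  qed (simp add: gauge_norm_zero)
qed (auto simp: gauge_norm_triangle gauge_norm_scaleR)

section \<open>Transfer of smoothness from the potential to the gauge\<close>

lemma norm_le_gauge_norm: "norm x \<le> level * gauge_norm x"
  using gauge_norm_ge[of x] level_pos by (simp add: field_simps)

text \<open>Admissible scales come arbitrarily close to 1 and none is below 1; Lipschitz continuity
  turns these facts into the two inequalities.\<close>

lemma potential_on_sphere:
  assumes "gauge_norm x = 1"
  shows "u x = level"
proof (rule antisym)
  show "u x \<le> level"
  proof (rule field_le_epsilon)
    fix e :: real assume e: "0 < e"
    \<comment> \<open>Dividing \<open>x\<close> by a scale between 1 and \<open>1 + d\<close> moves
      it by at most \<open>norm x * d\<close>, hence by at most \<open>e\<close>.\<close>
    define d where "d = e / (norm x + 1)"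
    have x1: "0 < norm x + 1" by (simp add: add_nonneg_pos)
    then have d: "0 < d" "norm x * d \<le> e"
      using e by (auto simp: d_def pos_divide_le_eq distrib_left mult.commute)
    obtain t where t: "t \<in> gauge_scales x" "t < 1 + d"
      using gauge_norm_approx[OF d(1), of x] assms by auto
    have t1: "1 \<le> t" using gauge_norm_le[OF t(1)] assms by simp
    have "u x \<le> u (x /\<^sub>R t) + norm (x - x /\<^sub>R t)" by (rule lipschitz)
    also have "x - x /\<^sub>R t = (1 - inverse t) *\<^sub>R x" by (simp add: scaleR_diff_left)
    also have "norm \<dots> = (1 - inverse t) * norm x"
      using t1 by (simp add: inverse_le_1_iff)
    also have "1 - inverse t \<le> d"
    proof -
      have "1 - inverse t = (t - 1) / t" using t1 by (simp add: field_simps)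
      also have "\<dots> \<le> (t - 1) / 1" using t1 by (intro divide_left_mono) auto
      finally show ?thesis using t by simp
    qed
    also have "u (x /\<^sub>R t) \<le> level" using t by (simp add: gauge_scales_def)
    finally show "u x \<le> level + e" using d by (simp add: mult_right_mono mult.commute)
  qed
  show "level \<le> u x"
  proof (rule field_le_epsilon)
    fix e :: real assume e: "0 < e"
    \<comment> \<open>A scale below 1 such that dividing by it moves \<open>x\<close> by
      \<open>e * (norm x / (norm x + 1))\<close>.\<close>
    define t where "t = 1 / (1 + e / (norm x + 1))"
    have t: "0 < t" "t < 1" "inverse t = 1 + e / (norm x + 1)"
      using e by (auto simp: t_def field_simps add_pos_nonneg)
    have "t \<notin> gauge_scales x" using gauge_norm_le[of t x] assms t by auto
    then have "level < u (x /\<^sub>R t)" using t by (simp add: gauge_scales_def)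
    also have "\<dots> \<le> u x + norm (x /\<^sub>R t - x)" by (rule lipschitz)
    also have "x /\<^sub>R t - x = (e / (norm x + 1)) *\<^sub>R x" using t by (simp add: scaleR_add_left)
    also have "norm \<dots> = e * (norm x / (norm x + 1))" using e by (simp add: abs_of_nonneg)
    also have "\<dots> \<le> e * 1"
      using e by (intro mult_left_mono) (auto simp: pos_divide_le_eq add_nonneg_pos)
    finally show "level \<le> u x + e" by simp
  qed
qed

text \<open>Reflect \<open>w\<close> in the weighted mean \<open>?m\<close>. Since
  \<open>t \<ge> 1 / 2\<close>, the point \<open>v\<close> lies on the segment from
  \<open>?m\<close> to the reflected point \<open>?m + ?h\<close>; convexity bounds
  \<open>u v\<close> there, and \<open>smooth\<close> handles the symmetric pair.\<close>

lemma smooth_weighted_aux: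
  assumes t: "1 / 2 \<le> t" "t \<le> 1"
  shows "t * u v + (1 - t) * u w \<le> u (t *\<^sub>R v + (1 - t) *\<^sub>R w) + C * norm (v - w) powr p"
proof -
  let ?m = "t *\<^sub>R v + (1 - t) *\<^sub>R w" and ?h = "t *\<^sub>R (v - w)"
  let ?a = "(1 - t) / t"
  have t0: "0 < t" using t by simp
  have a: "0 \<le> ?a" "?a \<le> 1" using t t0 by (auto simp: field_simps)
  have ah: "?a *\<^sub>R ?h = (1 - t) *\<^sub>R (v - w)" using t0 by simp
  have "?a *\<^sub>R (?m + ?h) + (1 - ?a) *\<^sub>R ?m = ?m + ?a *\<^sub>R ?h"
    by (simp add: algebra_simps)
  also have "\<dots> = v" unfolding ah by (simp add: algebra_simps)
  finally have "u v \<le> ?a * u (?m + ?h) + (1 - ?a) * u ?m"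
    using convex[OF a, of "?m + ?h" ?m] by simp
  then have "t * u v \<le> t * (?a * u (?m + ?h) + (1 - ?a) * u ?m)"
    using t0 by (simp add: mult_left_mono)
  also have "\<dots> = (1 - t) * u (?m + ?h) + (2 * t - 1) * u ?m"
    using t0 by (simp add: field_simps)
  finally have 1: "t * u v \<le> (1 - t) * u (?m + ?h) + (2 * t - 1) * u ?m" .
  have w: "?m - ?h = w" by (simp add: algebra_simps)
  have "u (?m + ?h) + u w \<le> 2 * u ?m + 2 * C * norm ?h powr p"
    using smooth[of ?m ?h] unfolding w .
  then have "(1 - t) * (u (?m + ?h) + u w) \<le> (1 - t) * (2 * u ?m + 2 * C * norm ?h powr p)"
    using t by (intro mult_left_mono) auto
  also have "\<dots> = (1 - t) * (2 * u ?m) + (2 * (1 - t)) * (C * norm ?h powr p)"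
    by (simp add: algebra_simps)
  \<comment> \<open>Here \<open>2 * (1 - t) \<le> 1\<close> because \<open>t \<ge> 1 / 2\<close>,
    and \<open>norm ?h \<le> norm (v - w)\<close> because \<open>t \<le> 1\<close>.\<close>
  also have "(2 * (1 - t)) * (C * norm ?h powr p) \<le> 1 * (C * norm (v - w) powr p)"
    using t p C by (intro mult_mono powr_mono2) (auto intro: mult_left_le_one_le)
  finally show ?thesis using 1 by (simp add: algebra_simps)
qed

lemma smooth_weighted:
  assumes t: "0 \<le> t" "t \<le> 1"
  shows "t * u v + (1 - t) * u w \<le> u (t *\<^sub>R v + (1 - t) *\<^sub>R w) + C * norm (v - w) powr p"
proof (cases "1 / 2 \<le> t")
  case True
  then show ?thesis using t by (intro smooth_weighted_aux)
next
  case False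
  then show ?thesis
    using smooth_weighted_aux[of "1 - t" w v] t by (simp add: add.commute norm_minus_commute)
qed

text \<open>Normalise \<open>x + h\<close> and \<open>x - h\<close> to points \<open>v\<close>,
  \<open>w\<close> of the sphere. A weighted mean of these is \<open>x\<close> shrunk by
  \<open>1 + g\<close>, where \<open>g\<close> is the quantity to bound. There \<open>u\<close> is
  below \<open>level\<close> by at least \<open>g / (1 + g)\<close>, but by
  \<open>smooth_weighted\<close> by at most \<open>C * norm (v - w) powr p\<close>.\<close>

lemma gauge_norm_smooth_small:
  assumes x: "gauge_norm x = 1" and h: "gauge_norm h = \<tau>" and \<tau>: "0 < \<tau>" "\<tau> \<le> 1 / 2"
  shows "(gauge_norm (x + h) + gauge_norm (x - h)) / 2 - 1 \<le> 2 * C * (12 * level) powr p * \<tau> powr p"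
proof -
  define A where "A = gauge_norm (x + h)"
  define B where "B = gauge_norm (x - h)"
  have A: "A \<le> 1 + \<tau>" "1 - \<tau> \<le> A"
    using gauge_norm_triangle[of x h] gauge_norm_triangle[of "x + h" "- h"] x h
    by (auto simp: A_def gauge_norm_minus)
  have B: "B \<le> 1 + \<tau>" "1 - \<tau> \<le> B"
    using gauge_norm_triangle[of x "- h"] gauge_norm_triangle[of "x - h" "h"] x h
    by (auto simp: B_def gauge_norm_minus)
  have A2: "1 / 2 \<le> A" and B2: "1 / 2 \<le> B" using A B \<tau> by auto
  define g where "g = (A + B) / 2 - 1"
  have "gauge_norm (2 *\<^sub>R x) \<le> A + B"
    using gauge_norm_triangle[of "x + h" "x - h"] by (simp add: A_def B_def scaleR_2)
  then have g: "0 \<le> g" "g \<le> 1 / 2"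
    using A B \<tau> x by (auto simp: g_def gauge_norm_scaleR)
  define v where "v = (x + h) /\<^sub>R A"
  define w where "w = (x - h) /\<^sub>R B"
  have "gauge_norm v = 1" "gauge_norm w = 1"
    using A2 B2 by (auto simp: v_def w_def gauge_norm_scaleR A_def[symmetric] B_def[symmetric])
  then have uvw: "u v = level" "u w = level" by (auto intro: potential_on_sphere)
  \<comment> \<open>These weights cancel the denominators of \<open>v\<close> and \<open>w\<close>,
    leaving a multiple of \<open>x\<close>.\<close>
  define t where "t = A / (A + B)"
  have t: "0 \<le> t" "t \<le> 1" "1 - t = B / (A + B)" using A2 B2 by (auto simp: t_def field_simps)
  have "t *\<^sub>R v = (1 / (A + B)) *\<^sub>R (x + h)" "(1 - t) *\<^sub>R w = (1 / (A + B)) *\<^sub>R (x - h)"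
    unfolding t(3) using A2 B2 by (auto simp: t_def v_def w_def)
  then have "t *\<^sub>R v + (1 - t) *\<^sub>R w = (1 / (A + B)) *\<^sub>R (2 *\<^sub>R x)"
    by (simp add: scaleR_2 algebra_simps)
  also have "\<dots> = (1 / (1 + g)) *\<^sub>R x" using A2 B2 by (simp add: g_def field_simps)
  finally have m: "t *\<^sub>R v + (1 - t) *\<^sub>R w = (1 / (1 + g)) *\<^sub>R x" .
  have "level \<le> u ((1 / (1 + g)) *\<^sub>R x) + C * norm (v - w) powr p"
    using smooth_weighted[OF t(1,2), of v w] unfolding m uvw by (simp add: algebra_simps)
  \<comment> \<open>Convexity between 0 and \<open>x\<close>; the rate is 1 because
    \<open>level - u 0 = 1\<close>.\<close>
  moreover have "u ((1 / (1 + g)) *\<^sub>R x) \<le> level - g / (1 + g)"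
  proof -
    have "u ((1 / (1 + g)) *\<^sub>R x) \<le> 1 / (1 + g) * u x + (1 - 1 / (1 + g)) * u 0"
      using g by (intro u_shrink) auto
    also have "u x = level" using x by (rule potential_on_sphere)
    also have "1 / (1 + g) * level + (1 - 1 / (1 + g)) * u 0 = level - (1 - 1 / (1 + g))"
      by (simp add: level_def algebra_simps add_divide_distrib)
    also have "1 - 1 / (1 + g) = g / (1 + g)" using g by (simp add: field_simps)
    finally show ?thesis .
  qed
  ultimately have "g / (1 + g) \<le> C * norm (v - w) powr p" by simp
  also have "norm (v - w) powr p \<le> (12 * level * \<tau>) powr p"
  proof (rule powr_mono2)
    have "v - w = (1 / A - 1 / B) *\<^sub>R x + (1 / A + 1 / B) *\<^sub>R h"
      by (simp add: v_def w_def algebra_simps divide_inverse)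
    then have "norm (v - w) \<le> \<bar>1 / A - 1 / B\<bar> * norm x + \<bar>1 / A + 1 / B\<bar> * norm h"
      by (metis norm_triangle_ineq norm_scaleR)
    \<comment> \<open>\<open>A\<close> and \<open>B\<close> are at least \<open>1 / 2\<close> and
      differ by at most \<open>2 * \<tau>\<close>; this gives the factors 8 and 4, which add up to
      12.\<close>
    also have "\<dots> \<le> (8 * \<tau>) * level + 4 * (level * \<tau>)"
    proof (intro add_mono mult_mono)
      have "1 / A - 1 / B = (B - A) / (A * B)" using A2 B2 by (simp add: field_simps)
      also have "\<bar>\<dots>\<bar> = \<bar>B - A\<bar> / (A * B)" using A2 B2 by (simp add: abs_divide abs_mult)
      also have "\<dots> \<le> (2 * \<tau>) / (1 / 2 * (1 / 2))"
        using A B A2 B2 by (intro frac_le mult_mono) (auto simp: abs_le_iff)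
      finally show "\<bar>1 / A - 1 / B\<bar> \<le> 8 * \<tau>" by simp
      have "1 / A \<le> 2" "1 / B \<le> 2" using A2 B2 by (auto simp: field_simps)
      then show "\<bar>1 / A + 1 / B\<bar> \<le> 4" using A2 B2 by simp
      show "norm x \<le> level" "norm h \<le> level * \<tau>"
        using norm_le_gauge_norm[of x] norm_le_gauge_norm[of h] x h by auto
    qed (use \<tau> in auto)
    finally show "norm (v - w) \<le> 12 * level * \<tau>" by (simp add: mult_ac)
  qed (use p in auto)
  also have "\<dots> = (12 * level) powr p * \<tau> powr p"
    using level_pos \<tau> by (simp add: powr_mult)
  finally have "g / (1 + g) \<le> C * ((12 * level) powr p * \<tau> powr p)"
    using C by (simp add: mult_left_mono)
  \<comment> \<open>As \<open>g \<le> 1 / 2\<close>, the denominator is below 2; this is the factor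
    2 in the constant.\<close>
  moreover have "g / 2 \<le> g / (1 + g)" using g by (intro divide_left_mono) auto
  ultimately have "g \<le> 2 * C * (12 * level) powr p * \<tau> powr p"
    unfolding mult.assoc by linarith
  then show ?thesis by (simp only: g_def A_def B_def)
qed

text \<open>For \<open>\<tau> > 1 / 2\<close> the triangle inequality alone gives the bound
  \<open>\<tau>\<close>, which is at most \<open>2 powr (p - 1) * \<tau> powr p\<close>; hence the
  second summand of the constant.\<close>

lemma p_uniformly_smooth_gauge_norm: "p_uniformly_smooth_norm p gauge_norm"
  unfolding p_uniformly_smooth_norm_def
proof (intro exI[of _ "2 * C * (12 * level) powr p + 2 powr (p - 1)"] conjI allI impI)
  show "0 < 2 * C * (12 * level) powr p + 2 powr (p - 1)"
    using C by (intro add_nonneg_pos) auto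
  fix \<tau> :: real and x y :: 'a
  assume \<tau>: "0 < \<tau>" and xy: "gauge_norm x = 1" "gauge_norm y = 1"
  have h: "gauge_norm (\<tau> *\<^sub>R y) = \<tau>" using \<tau> xy by (simp add: gauge_norm_scaleR)
  let ?l = "(gauge_norm (x + \<tau> *\<^sub>R y) + gauge_norm (x - \<tau> *\<^sub>R y)) / 2 - 1"
  have C': "0 \<le> 2 * C * (12 * level) powr p * \<tau> powr p" using C by simp
  show "?l \<le> (2 * C * (12 * level) powr p + 2 powr (p - 1)) * \<tau> powr p"
  proof (cases "\<tau> \<le> 1 / 2")
    case True
    then have "?l \<le> 2 * C * (12 * level) powr p * \<tau> powr p"
      using xy h \<tau> by (intro gauge_norm_smooth_small)
    also have "\<dots> \<le> (2 * C * (12 * level) powr p + 2 powr (p - 1)) * \<tau> powr p"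
      by (intro mult_right_mono) auto
    finally show ?thesis .
  next
    case False
    have "?l \<le> \<tau>"
      using gauge_norm_triangle[of x "\<tau> *\<^sub>R y"] gauge_norm_triangle[of x "- (\<tau> *\<^sub>R y)"] xy h
      by (simp add: gauge_norm_minus field_simps)
    also have "\<dots> \<le> (2 * \<tau>) powr (p - 1) * \<tau>"
      using False p \<tau> ge_one_powr_ge_zero[of "2 * \<tau>" "p - 1"] by simp
    also have "\<dots> = 2 powr (p - 1) * \<tau> powr p"
      using \<tau> by (simp add: powr_mult powr_diff)
    finally show ?thesis using C' unfolding distrib_right by linarith
  qed
qed

end

theorem theorem3p10:
  fixes p :: real
  assumes "1 < p" and "p \<le> 2"
    and "azuma_type p TYPE('a::{banach,second_countable_topology})"
  shows "\<exists>N :: 'a \<Rightarrow> real. equivalent_norm N \<and> p_uniformly_smooth_norm p N"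
proof -
  obtain L where L: "\<And>T::'a walk. within_budget p 1 T \<Longrightarrow> mean_norm 0 T \<le> L"
    using azuma_type_mean_norm_bound[OF assms(1,3)] by blast
  have "0 \<le> L" using L[of Stop] by simp
  let ?C = "L + 2"
  have bound: "mean_norm 0 T \<le> L + ?C * mean_cost p T" for T :: "'a walk"
    using mean_norm_le_cost[OF assms(1) L] .
  \<comment> \<open>With the cost rate of the restart argument the walk potential is a smooth
    potential, so its gauge is the required norm.\<close>
  interpret smooth_potential "walk_potential p ?C :: 'a \<Rightarrow> real" p ?C
  proof
    show "1 < p" "0 \<le> ?C" using assms(1) \<open>0 \<le> L\<close> by auto
  qed (erule (1) walk_potential_convex[OF bound] | rule walk_potential_ge_norm[OF bound]
      walk_potential_even[OF bound] walk_potential_lipschitz[OF bound] walk_potential_smooth[OF bound])+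
  show ?thesis
    using equivalent_gauge_norm p_uniformly_smooth_gauge_norm by blast
qed

end
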